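(* Let $\vec G_1$ and $\vec G_2$ be any two realizations of the same directed degree sequence. Modify the definition of the weighted swap-distance so that, besides $C_4$-swaps (weight $1$), any circuit of length 6 (triangular or not) can be swapped in one step with weight $2$, and let $\mathbf{dist}'(\vec G_1,\vec G_2)$ be the resulting minimum total weight of a swap sequence transforming $\vec G_1$ into $\vec G_2$. Then $$\mathbf{dist}'(\vec G_1,\vec G_2)=H'(\vec G_1,\vec G_2)-\mathbf{maxC}_d(\vec G_1,\vec G_2),$$ and there exists a shortest (minimum total weight) swap sequence from $\vec G_1$ to $\vec G_2$ which contains only $C_4$-swaps and triangular $C_6$-swaps.
   Context: Directed graphs are finite, without loops and without parallel edges (both $xy$ and $yx$ may be present), with labeled vertices $x_1,\dots,x_n$. The directed degree sequence of $\vec G$ is the pair of sequences of out-degrees and in-degrees of the vertices; $\vec G$ is then called a realization of this pair. Bipartite representation: $B(\vec G)$ has classes $U=\{u_x\}$ and $W=\{w_x\}$, one copy of each vertex $x$ in each class, and the directed edge $xy$ is represented by the edge $u_xw_y$. The pairs $u_xw_x$ are non-chords (they can never be edges); all other pairs $u_xw_y$ ($x\neq y$) are chords. Swaps: a $C_4$-swap takes distinct $u_x,u_z\in U$ and distinct $w_y,w_t\in W$ such that all four pairs between them are chords, with $u_xw_y,u_zw_t$ edges and $u_xw_t,u_zw_y$ non-edges, and replaces the edges $u_xw_y,u_zw_t$ by $u_xw_t,u_zw_y$. Swapping a circuit of length 6 means: taking a 6-cycle of chords on three distinct vertices of $U$ and three distinct vertices of $W$ whose pairs are alternately edges and non-edges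 of the current graph, and exchanging the edges with the non-edges along it. A triangular $C_6$-swap is such a 6-cycle swap in which the three opposite pairs of the 6-cycle are all non-chords; equivalently, an oriented triangle $xy,yz,zx$ (with $yx,zy,xz$ absent) is replaced by the oppositely oriented triangle $yx,zy,xz$. $H'(\vec G_1,\vec G_2)=|E(\vec G_1)\,\Delta\, E(\vec G_2)|/2$, where $\Delta$ is the symmetric difference of the sets of directed edges. The red-blue directed graph associated with $\vec G_1,\vec G_2$ has the common vertex set, directed edge set $E(\vec G_1)\,\Delta\, E(\vec G_2)$, edges of $E(\vec G_1)\setminus E(\vec G_2)$ red and edges of $E(\vec G_2)\setminus E(\vec G_1)$ blue. An alternating circuit in it is a closed trail (orientations ignored when traversing, each directed edge used at most once) along which, cyclically, both the colors and the directions alternate: consecutive edges have different colors and are either both directed into or both directed out of their common vertex in the trail. The edge set can always be decomposed into alternating circuits, and $\mathbf{maxC}_d(\vec G_1,\vec G_2)$ is the maximum number of circuits in such a decomposition. *)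

theory Defs
  imports Complex_Main "HOL-Library.Disjoint_Sets" "Graph_Theory.Pair_Digraph"
begin

text \<open>
  Digraphs are terms \<open>G :: 'a pair_pre_digraph\<close> with \<open>pair_digraph G\<close>: finitely many vertices,
  arcs are pairs (so there are no parallel arcs, but antiparallel ones are allowed), no loops.
\<close>

definition realization ::
    "'a set \<Rightarrow> ('a \<Rightarrow> nat) \<Rightarrow> ('a \<Rightarrow> nat) \<Rightarrow> 'a pair_pre_digraph \<Rightarrow> bool" where
  "realization V dout din G \<longleftrightarrow> pair_digraph G \<and> pverts G = V \<and>
     (\<forall>v\<in>V. out_degree (with_proj G) v = dout v \<and> in_degree (with_proj G) v = din v)"


section \<open>Swaps\<close>

text \<open>
  In the bipartite representation the pair of \<open>u\<^sub>x \<in> U\<close> and \<open>w\<^sub>y \<in> W\<close> is encoded as \<open>(x, y)\<close>, so the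
  edges of the bipartite representation are the arcs of the digraph.  The first component always
  stands for a vertex in \<open>U\<close> and the second one for a vertex in \<open>W\<close>; an equality \<open>x = y\<close> between
  a first and a second component therefore only says that the pair \<open>(x, y)\<close> is a non-chord.
\<close>

definition chord :: "'a pair_pre_digraph \<Rightarrow> 'a \<times> 'a \<Rightarrow> bool" where
  "chord G e \<longleftrightarrow> fst e \<in> pverts G \<and> snd e \<in> pverts G \<and> fst e \<noteq> snd e"

text \<open>
  \<open>C4_Swap x y z t\<close> is the swap along the 4-cycle \<open>u\<^sub>x w\<^sub>y u\<^sub>z w\<^sub>t\<close>, and
  \<open>C6_Swap a p b q c r\<close> the swap along the 6-cycle \<open>u\<^sub>a w\<^sub>p u\<^sub>b w\<^sub>q u\<^sub>c w\<^sub>r\<close>.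
\<close>

datatype 'a swap =
    C4_Swap 'a 'a 'a 'a
  | C6_Swap 'a 'a 'a 'a 'a 'a

fun cycle_vertices_distinct :: "'a swap \<Rightarrow> bool" where
  "cycle_vertices_distinct (C4_Swap x y z t) \<longleftrightarrow> distinct [x, z] \<and> distinct [y, t]"
| "cycle_vertices_distinct (C6_Swap a p b q c r) \<longleftrightarrow> distinct [a, b, c] \<and> distinct [p, q, r]"

fun removed_arcs :: "'a swap \<Rightarrow> ('a \<times> 'a) set" where
  "removed_arcs (C4_Swap x y z t) = {(x, y), (z, t)}"
| "removed_arcs (C6_Swap a p b q c r) = {(a, p), (b, q), (c, r)}"

fun added_arcs :: "'a swap \<Rightarrow> ('a \<times> 'a) set" where
  "added_arcs (C4_Swap x y z t) = {(x, t), (z, y)}"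
| "added_arcs (C6_Swap a p b q c r) = {(b, p), (c, q), (a, r)}"

definition allowed_swap :: "'a pair_pre_digraph \<Rightarrow> 'a swap \<Rightarrow> bool" where
  "allowed_swap G s \<longleftrightarrow> cycle_vertices_distinct s \<and>
     (\<forall>e \<in> removed_arcs s \<union> added_arcs s. chord G e) \<and>
     removed_arcs s \<subseteq> parcs G \<and> added_arcs s \<inter> parcs G = {}"

definition apply_swap :: "'a swap \<Rightarrow> 'a pair_pre_digraph \<Rightarrow> 'a pair_pre_digraph" where
  "apply_swap s G = G\<lparr>parcs := (parcs G - removed_arcs s) \<union> added_arcs s\<rparr>"

fun is_C4_swap :: "'a swap \<Rightarrow> bool" where
  "is_C4_swap (C4_Swap x y z t) \<longleftrightarrow> True"
| "is_C4_swap (C6_Swap a p b q c r) \<longleftrightarrow> False"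

text \<open>The three pairs below are the opposite pairs of the 6-cycle.  Only the vertex set of \<open>G\<close>
  matters here, and swaps do not change it.\<close>

fun is_triangular_C6_swap :: "'a pair_pre_digraph \<Rightarrow> 'a swap \<Rightarrow> bool" where
  "is_triangular_C6_swap G (C4_Swap x y z t) \<longleftrightarrow> False"
| "is_triangular_C6_swap G (C6_Swap a p b q c r) \<longleftrightarrow>
     \<not> chord G (a, q) \<and> \<not> chord G (b, r) \<and> \<not> chord G (c, p)"

fun swap_weight :: "'a swap \<Rightarrow> nat" where
  "swap_weight (C4_Swap x y z t) = 1"
| "swap_weight (C6_Swap a p b q c r) = 2"

fun swap_sequence :: "'a pair_pre_digraph \<Rightarrow> 'a swap list \<Rightarrow> 'a pair_pre_digraph \<Rightarrow> bool" where
  "swap_sequence G [] H \<longleftrightarrow> G = H"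
| "swap_sequence G (s # ss) H \<longleftrightarrow> allowed_swap G s \<and> swap_sequence (apply_swap s G) ss H"

definition total_weight :: "'a swap list \<Rightarrow> nat" where
  "total_weight ss = sum_list (map swap_weight ss)"

text \<open>The value is unspecified if no swap sequence from \<open>G\<close> to \<open>H\<close> exists.\<close>

definition dist' :: "'a pair_pre_digraph \<Rightarrow> 'a pair_pre_digraph \<Rightarrow> nat" where
  "dist' G H = (LEAST w. \<exists>ss. swap_sequence G ss H \<and> total_weight ss = w)"


section \<open>Red-blue graph and alternating circuits\<close>

definition red_arcs :: "'a pair_pre_digraph \<Rightarrow> 'a pair_pre_digraph \<Rightarrow> ('a \<times> 'a) set" where
  "red_arcs G H = parcs G - parcs H"

definition blue_arcs :: "'a pair_pre_digraph \<Rightarrow> 'a pair_pre_digraph \<Rightarrow> ('a \<times> 'a) set" where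
  "blue_arcs G H = parcs H - parcs G"

definition H' :: "'a pair_pre_digraph \<Rightarrow> 'a pair_pre_digraph \<Rightarrow> real" where
  "H' G H = real (card (red_arcs G H \<union> blue_arcs G H)) / 2"

text \<open>
  The circuit visits the vertices \<open>vs ! 0, vs ! 1, \<dots>\<close> cyclically; \<open>es ! i\<close> joins \<open>vs ! i\<close> to its
  cyclic successor, in either orientation.
\<close>

definition alternating_circuit ::
    "'a pair_pre_digraph \<Rightarrow> 'a pair_pre_digraph \<Rightarrow> 'a list \<Rightarrow> ('a \<times> 'a) list \<Rightarrow> bool" where
  "alternating_circuit G H vs es \<longleftrightarrow>
     es \<noteq> [] \<and> length vs = length es \<and> distinct es \<and>
     set es \<subseteq> red_arcs G H \<union> blue_arcs G H \<and>
     (\<forall>i < length es. let j = Suc i mod length es; e = es ! i; f = es ! j; v = vs ! j in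
        (e = (vs ! i, v) \<or> e = (v, vs ! i)) \<and>
        (e \<in> red_arcs G H \<longleftrightarrow> f \<in> blue_arcs G H) \<and>
        ((snd e = v \<and> snd f = v) \<or> (fst e = v \<and> fst f = v)))"

definition circuit_decomposition ::
    "'a pair_pre_digraph \<Rightarrow> 'a pair_pre_digraph \<Rightarrow> ('a \<times> 'a) set set \<Rightarrow> bool" where
  "circuit_decomposition G H P \<longleftrightarrow> partition_on (red_arcs G H \<union> blue_arcs G H) P \<and>
     (\<forall>C\<in>P. \<exists>vs es. alternating_circuit G H vs es \<and> set es = C)"

definition maxC_d :: "'a pair_pre_digraph \<Rightarrow> 'a pair_pre_digraph \<Rightarrow> nat" where
  "maxC_d G H = Max {card P |P. circuit_decomposition G H P}"

end

theory Submission
  imports Defs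
begin

text \<open>
  Call a set \<open>S\<close> of arcs balanced with respect to \<open>E\<close> if at every out-vertex and every in-vertex it
  has as many arcs in \<open>E\<close> (red) as outside \<open>E\<close> (blue).  In the bipartite representation every
  nonempty balanced set contains an alternating cycle and its complement in a balanced set is
  balanced, so partitions into balanced sets, into circuits and into cycles all have the same
  maximal number of parts.

  Upper bound: an alternating cycle of length \<open>2k\<close> can be swapped with total weight \<open>k - 1\<close>.  A chord
  that is a diagonal cuts it into cycles of lengths \<open>2i\<close> and \<open>2j\<close> with \<open>i + j = k + 1\<close>.  Each vertex lies
  in only one non-chord, so a diagonal chord exists unless \<open>k = 2\<close> or the cycle is triangular.

  Lower bound: let a swap turn \<open>E\<close> into \<open>E'\<close> and consider a balanced partition of the difference of
  \<open>E'\<close> and the target \<open>F\<close>.  The parts that avoid the swapped arcs remain balanced with respect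
  to \<open>E\<close>, and what they leave uncovered of the difference of \<open>E\<close> and \<open>F\<close> is one more balanced set.
  Each of the \<open>c\<close> common arcs destroys at most one part but shrinks the difference by two arcs.
\<close>

section \<open>Balanced arc sets\<close>

text \<open>With \<open>g = fst\<close> arcs are counted at the copy of \<open>x\<close> in U, with
  \<open>g = snd\<close> at the copy in W. Keeping the end as a parameter lets each argument run
  once for both classes.\<close>

definition deg :: "('a \<times> 'a \<Rightarrow> 'a) \<Rightarrow> ('a \<times> 'a) set \<Rightarrow> 'a \<Rightarrow> nat" where
  "deg g A x = (\<Sum>e\<in>A. if g e = x then 1 else 0)"

definition balanced :: "('a \<times> 'a) set \<Rightarrow> ('a \<times> 'a) set \<Rightarrow> bool" where
  "balanced E S \<longleftrightarrow> finite S \<and> (\<forall>g\<in>{fst, snd}. \<forall>x. deg g (S \<inter> E) x = deg g (S - E) x)"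

lemma deg_card: "finite A \<Longrightarrow> deg g A x = card {e \<in> A. g e = x}"
  by (simp add: deg_def sum.If_cases Int_def)

lemma deg_Un_disjoint:
  "finite A \<Longrightarrow> finite B \<Longrightarrow> A \<inter> B = {} \<Longrightarrow> deg g (A \<union> B) x = deg g A x + deg g B x"
  by (simp add: deg_def sum.union_disjoint)

lemma deg_Diff:
  assumes "finite A" "B \<subseteq> A"
  shows "deg g (A - B) x = deg g A x - deg g B x" "deg g B x \<le> deg g A x"
proof -
  have "deg g ((A - B) \<union> B) x = deg g (A - B) x + deg g B x"
    using assms by (intro deg_Un_disjoint) (auto intro: finite_subset)
  moreover have "(A - B) \<union> B = A" using assms by blast
  ultimately show "deg g (A - B) x = deg g A x - deg g B x" "deg g B x \<le> deg g A x" by auto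
qed

lemma balanced_finite: "balanced E S \<Longrightarrow> finite S"
  by (simp add: balanced_def)

lemma balanced_empty: "balanced E {}"
  by (simp add: balanced_def)

text \<open>Only the colours of the arcs in \<open>S\<close> matter, so a balanced set survives
  every change of \<open>E\<close> that avoids it.\<close>

lemma balanced_cong: "S \<inter> E = S \<inter> E' \<Longrightarrow> balanced E S \<longleftrightarrow> balanced E' S"
proof -
  assume "S \<inter> E = S \<inter> E'"
  moreover from this have "S - E = S - E'" by blast
  ultimately show ?thesis by (simp add: balanced_def)
qed

lemma balanced_Diff:
  assumes "balanced E S" "balanced E T" "T \<subseteq> S"
  shows "balanced E (S - T)"
proof -
  have fin: "finite S" using assms by (simp add: balanced_def)
  have "deg g ((S - T) \<inter> E) x = deg g ((S - T) - E) x" if "g \<in> {fst, snd}" for g x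
  proof -
    have "(S - T) \<inter> E = (S \<inter> E) - (T \<inter> E)" "(S - T) - E = (S - E) - (T - E)" by auto
    moreover have "deg g ((S \<inter> E) - (T \<inter> E)) x = deg g (S \<inter> E) x - deg g (T \<inter> E) x"
      "deg g ((S - E) - (T - E)) x = deg g (S - E) x - deg g (T - E) x"
      using fin assms(3) by (auto intro!: deg_Diff)
    ultimately show ?thesis using assms(1,2) that by (metis balanced_def)
  qed
  then show ?thesis using fin by (simp add: balanced_def)
qed

lemma balanced_Un_disjoint:
  assumes "balanced E S" "balanced E T" "S \<inter> T = {}"
  shows "balanced E (S \<union> T)"
proof -
  have fin: "finite S" "finite T" using assms by (simp_all add: balanced_def)
  have "deg g ((S \<union> T) \<inter> E) x = deg g ((S \<union> T) - E) x" if "g \<in> {fst, snd}" for g x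
  proof -
    have "deg g ((S \<inter> E) \<union> (T \<inter> E)) x = deg g (S \<inter> E) x + deg g (T \<inter> E) x"
      "deg g ((S - E) \<union> (T - E)) x = deg g (S - E) x + deg g (T - E) x"
      using fin assms(3) by (auto intro!: deg_Un_disjoint)
    then show ?thesis using assms(1,2) that unfolding balanced_def Int_Un_distrib2 Un_Diff by metis
  qed
  then show ?thesis using fin by (simp add: balanced_def)
qed

lemma balanced_Union:
  assumes "finite P" "disjoint P" "\<And>D. D \<in> P \<Longrightarrow> balanced E D"
  shows "balanced E (\<Union>P)"
  using assms
proof (induction P rule: finite_induct)
  case (insert D P)
  then have "D \<inter> \<Union>P = {}" "disjoint P" by (auto simp: disjoint_def)
  with insert show ?case by (simp add: balanced_Un_disjoint)
qed (simp add: balanced_empty)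

lemma deg_pos_iff: "finite A \<Longrightarrow> deg g A x > 0 \<longleftrightarrow> (\<exists>e\<in>A. g e = x)"
  by (auto simp: deg_card card_gt_0_iff)

lemma balanced_partner:
  assumes "balanced E S" "e \<in> S" "g \<in> {fst, snd}"
  shows "e \<in> E \<Longrightarrow> \<exists>f\<in>S - E. g f = g e" "e \<notin> E \<Longrightarrow> \<exists>f\<in>S \<inter> E. g f = g e"
proof -
  have *: "deg g (S \<inter> E) (g e) = deg g (S - E) (g e)" "finite (S \<inter> E)" "finite (S - E)"
    using assms by (auto simp: balanced_def)
  show "e \<in> E \<Longrightarrow> \<exists>f\<in>S - E. g f = g e"
    using * assms(2) by (metis IntI deg_pos_iff)
  show "e \<notin> E \<Longrightarrow> \<exists>f\<in>S \<inter> E. g f = g e"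
    using * assms(2) by (metis DiffI deg_pos_iff)
qed

text \<open>Any arc has a partner of the other colour at its tail. The bound pays for the case of
  the lower bound in which nothing is left over.\<close>

lemma balanced_card_ge_2:
  assumes "balanced E S" "S \<noteq> {}"
  shows "2 \<le> card S"
proof -
  obtain e where "e \<in> S" using assms by auto
  with balanced_partner[OF assms(1) this, of fst] obtain f where "f \<in> S" "f \<noteq> e"
    by (cases "e \<in> E") auto
  with \<open>e \<in> S\<close> have "card {e, f} \<le> card S"
    using assms(1) by (intro card_mono) (auto simp: balanced_def)
  with \<open>f \<noteq> e\<close> show ?thesis by simp
qed

text \<open>The common arcs of \<open>E\<close> and \<open>F\<close> contribute equally to both
  degrees and cancel.\<close>

lemma balanced_sym_diff_iff:
  assumes "finite E" "finite F"
  shows "balanced E (sym_diff E F) \<longleftrightarrow> (\<forall>g\<in>{fst, snd}. \<forall>x. deg g E x = deg g F x)"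
proof -
  have "deg g (sym_diff E F \<inter> E) x = deg g (sym_diff E F - E) x \<longleftrightarrow> deg g E x = deg g F x" for g x
  proof -
    have "deg g E x = deg g (E - F) x + deg g (E \<inter> F) x"
      "deg g F x = deg g (F - E) x + deg g (E \<inter> F) x"
      using assms deg_Un_disjoint[of "E - F" "E \<inter> F" g x] deg_Un_disjoint[of "F - E" "F \<inter> E" g x]
      unfolding Un_Diff_Int by (auto simp: Int_commute)
    moreover have "sym_diff E F \<inter> E = E - F" "sym_diff E F - E = F - E" by auto
    ultimately show ?thesis by simp
  qed
  then show ?thesis using assms by (simp add: balanced_def)
qed

section \<open>The lower bound\<close>

text \<open>For a swap of weight \<open>w\<close> the sets \<open>E\<close> and \<open>E'\<close>
  differ in \<open>2 * w + 2\<close> arcs. The inequality then says that half the size of the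
  difference minus the number of parts can drop by at most \<open>w\<close>; the additive form
  avoids truncated subtraction.\<close>

lemma balanced_partition_flip:
  assumes fin: "finite E" "finite E'" "finite F"
    and bal: "balanced E (sym_diff E F)"
    and ne: "E \<noteq> E'"
    and P': "partition_on (sym_diff E' F) P'" "\<And>D. D \<in> P' \<Longrightarrow> balanced E' D"
  obtains P where "partition_on (sym_diff E F) P" "\<And>D. D \<in> P \<Longrightarrow> balanced E D"
    "card (sym_diff E F) + 2 * card P' + 2 \<le> card (sym_diff E' F) + 2 * card P + card (sym_diff E E')"
proof -
  define C where "C = sym_diff E E'"
  define T where "T = {D \<in> P'. D \<inter> C \<noteq> {}}"
  define R where "R = sym_diff E F - \<Union>(P' - T)"
  \<comment> \<open>The leftover \<open>R\<close> becomes a part only if it is nonempty, as parts of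
    a partition must be.\<close>
  define P where "P = (P' - T) \<union> (if R = {} then {} else {R})"
  have finC: "finite C" using fin by (simp add: C_def)
  have finP': "finite P'" using finite_elements[OF _ P'(1)] fin by simp
  have UP': "\<Union>P' = sym_diff E' F" and dP': "disjoint P'" and nP': "{} \<notin> P'"
    using P'(1) by (auto simp: partition_on_def)
  have avoid: "D \<inter> C = {}" if "D \<in> P' - T" for D using that by (auto simp: T_def)
  then have sub: "\<Union>(P' - T) \<subseteq> sym_diff E F"
    using UP' unfolding C_def by blast
  have balD: "balanced E D" if "D \<in> P' - T" for D
    using P'(2)[of D] that avoid[OF that] balanced_cong[of D E E'] unfolding C_def by blast
  have dsub: "disjoint (P' - T)" using dP' by (auto simp: disjoint_def)
  have balR: "balanced E R"
    unfolding R_def using bal sub balD dsub finP' by (intro balanced_Diff balanced_Union) auto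
  have "partition_on (sym_diff E F) P"
  proof (cases "R = {}")
    case True
    then show ?thesis using sub dsub nP' by (auto simp: P_def R_def partition_on_def)
  next
    case False
    have "partition_on (sym_diff E F) (insert R (P' - T))"
    proof (subst partition_on_insert)
      show "disjnt R (\<Union>(P' - T))" by (auto simp: R_def disjnt_def)
      have "sym_diff E F - R = \<Union>(P' - T)" using sub by (auto simp: R_def)
      then show "partition_on (sym_diff E F - R) (P' - T) \<and> R \<subseteq> sym_diff E F \<and> R \<noteq> {}"
        using False dsub nP' by (auto simp: partition_on_def R_def)
    qed
    then show ?thesis using False by (simp add: P_def)
  qed
  moreover have "balanced E D" if "D \<in> P" for D
    using that balD balR by (auto simp: P_def split: if_splits)
  moreover have "card (sym_diff E F) + 2 * card P' + 2 \<le>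
      card (sym_diff E' F) + 2 * card P + card C"
  proof -
    define c where "c = card (C \<inter> sym_diff E' F)"
    \<comment> \<open>\<open>sym_diff E F\<close> is the symmetric difference of \<open>C\<close>
      and \<open>sym_diff E' F\<close>, so each of their common arcs is lost twice.\<close>
    have 1: "card (sym_diff E F) + 2 * c = card C + card (sym_diff E' F)"
    proof -
      let ?X = "C" and ?Y = "sym_diff E' F"
      have "sym_diff E F = (?X - ?Y) \<union> (?Y - ?X)" by (auto simp: C_def)
      then have "card (sym_diff E F) = card (?X - ?Y) + card (?Y - ?X)"
        using fin finC by (simp add: card_Un_disjoint Diff_disjoint disjoint_iff)
      moreover have "card ?X = card (?X - ?Y) + card (?X \<inter> ?Y)"
        using finC by (metis Int_commute card_Diff_subset_Int card_mono finite_Int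
            inf.cobounded1 le_add_diff_inverse2)
      moreover have "card ?Y = card (?Y - ?X) + card (?X \<inter> ?Y)"
        using fin by (metis Int_commute card_Diff_subset_Int card_mono finite_Int finite_Diff finite_UnI
            inf.cobounded1 le_add_diff_inverse2)
      ultimately show ?thesis by (simp add: c_def)
    qed
    have finT: "finite T" "T \<subseteq> P'" using finP' by (auto simp: T_def)
    have UT: "(\<Union>D\<in>T. D \<inter> C) = C \<inter> sym_diff E' F" using UP' by (auto simp: T_def)
    have csum: "c = (\<Sum>D\<in>T. card (D \<inter> C))"
      unfolding c_def UT[symmetric] using finT finC dP'
      by (intro card_UN_disjoint) (auto simp: disjoint_def)
    have "card P = card (P' - T) + (if R = {} then 0 else 1)"
    proof (cases "R = {}")
      case False
      then have "R \<notin> P' - T" by (auto simp: R_def)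
      then show ?thesis using False finP' by (simp add: P_def)
    qed (simp add: P_def)
    moreover have "card (P' - T) = card P' - card T" "card T \<le> card P'"
      using finT finP' by (auto simp: card_Diff_subset card_mono finite_subset)
    \<comment> \<open>Without a leftover no part is gained, so a strict bound is needed. In this
      case \<open>C\<close> lies inside \<open>sym_diff E' F\<close>, hence \<open>c > 0\<close>,
      and each destroyed part lies inside \<open>C\<close> and so uses up at least two common
      arcs.\<close>
    moreover have "card T + 1 \<le> c" if "R = {}"
    proof -
      have Ceq: "sym_diff E F \<subseteq> \<Union>(P' - T)" using that by (auto simp: R_def)
      have "C \<subseteq> sym_diff E' F"
      proof
        fix e assume "e \<in> C"
        then have "e \<notin> \<Union>(P' - T)" using avoid by blast
        then show "e \<in> sym_diff E' F" using Ceq \<open>e \<in> C\<close> by (auto simp: C_def)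
      qed
      then have "c = card C" by (simp add: c_def Int_absorb2)
      then have cpos: "c > 0" using ne finC by (auto simp: C_def card_gt_0_iff)
      have "D \<subseteq> C" if "D \<in> T" for D
      proof (rule ccontr)
        assume "\<not> D \<subseteq> C"
        then obtain e where e: "e \<in> D" "e \<notin> C" by blast
        then have "e \<in> sym_diff E' F" using UP' finT that by blast
        then have "e \<in> sym_diff E F" using e by (auto simp: C_def)
        then obtain D' where "D' \<in> P' - T" "e \<in> D'" using Ceq by blast
        moreover from this that finT have "D \<noteq> D'" "D \<in> P'" by auto
        ultimately show False using dP' e(1) unfolding disjoint_def by blast
      qed
      then have "2 \<le> card (D \<inter> C)" if "D \<in> T" for D
        using balanced_card_ge_2[of E' D] P'(2)[of D] nP' finT that by (metis inf.absorb1 subsetD)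
      then have "(\<Sum>D\<in>T. 2) \<le> c" unfolding csum by (intro sum_mono) auto
      then show ?thesis using cpos by simp
    qed
    moreover have "card T \<le> c"
    proof -
      have "(\<Sum>D\<in>T. 1) \<le> c" unfolding csum
        using finC by (intro sum_mono) (auto simp: T_def Suc_le_eq card_gt_0_iff)
      then show ?thesis by simp
    qed
    ultimately show ?thesis using 1 by (auto split: if_splits)
  qed
  ultimately show ?thesis using that unfolding C_def by blast
qed

lemma swap_arcs_deg:
  assumes "cycle_vertices_distinct s" "g \<in> {fst, snd}"
  shows "deg g (removed_arcs s) x = deg g (added_arcs s) x"
  using assms by (cases s) (auto simp: deg_def)

text \<open>Either kind of swap along a cycle of length 2k costs k - 1; this is all that the lower
  bound needs to know about weights.\<close>

lemma swap_arcs_card: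
  assumes "cycle_vertices_distinct s"
  shows "card (removed_arcs s) = swap_weight s + 1" "card (added_arcs s) = swap_weight s + 1"
  using assms by (cases s; auto)+

lemma finite_swap_arcs: "finite (removed_arcs s)" "finite (added_arcs s)"
  by (cases s; simp)+

lemma allowed_swap_effect:
  assumes "allowed_swap G s" "finite (parcs G)"
  defines "E' \<equiv> parcs (apply_swap s G)"
  shows "finite E'" "card (sym_diff (parcs G) E') = 2 * swap_weight s + 2"
    "g \<in> {fst, snd} \<Longrightarrow> deg g E' x = deg g (parcs G) x"
proof -
  let ?R = "removed_arcs s" and ?A = "added_arcs s" and ?E = "parcs G"
  have d: "cycle_vertices_distinct s" "?R \<subseteq> ?E" "?A \<inter> ?E = {}"
    using assms(1) by (auto simp: allowed_swap_def)
  have E': "E' = (?E - ?R) \<union> ?A" by (simp add: E'_def apply_swap_def)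
  show "finite E'" using assms(2) by (simp add: E' finite_swap_arcs)
  have "sym_diff ?E E' = ?R \<union> ?A" using d by (auto simp: E')
  moreover have "card (?R \<union> ?A) = card ?R + card ?A"
    using d by (intro card_Un_disjoint finite_swap_arcs) auto
  ultimately show "card (sym_diff ?E E') = 2 * swap_weight s + 2"
    using swap_arcs_card[OF d(1)] by simp
  assume g: "g \<in> {fst, snd}"
  have "deg g E' x = deg g (?E - ?R) x + deg g ?A x"
    unfolding E' using d assms(2) by (intro deg_Un_disjoint) (auto simp: finite_swap_arcs)
  then show "deg g E' x = deg g ?E x"
    using deg_Diff[OF assms(2) d(2), of g x] swap_arcs_deg[OF d(1) g, of x] by simp
qed

text \<open>Induction from the front of the sequence with the target fixed, starting from the empty
  partition. Equality of degrees is carried along because it makes the difference before each swap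
  balanced.\<close>

lemma swap_sequence_balanced_partition:
  assumes "swap_sequence G ss H" "finite (parcs G)"
  shows "finite (parcs H) \<and> (\<forall>g\<in>{fst, snd}. \<forall>x. deg g (parcs G) x = deg g (parcs H) x) \<and>
    (\<exists>P. partition_on (sym_diff (parcs G) (parcs H)) P \<and> (\<forall>D\<in>P. balanced (parcs G) D) \<and>
      card (sym_diff (parcs G) (parcs H)) \<le> 2 * (total_weight ss + card P))"
  using assms
proof (induction ss arbitrary: G)
  case Nil
  have "partition_on {} {}" by (simp add: partition_on_empty)
  then show ?case using Nil by (auto simp: total_weight_def intro!: exI[of _ "{}"])
next
  case (Cons s ss)
  let ?G' = "apply_swap s G"
  have s: "allowed_swap G s" "swap_sequence ?G' ss H" using Cons.prems by auto
  note eff = allowed_swap_effect[OF s(1) Cons.prems(2)]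
  obtain P' where IH: "finite (parcs H)"
      "\<And>g x. g \<in> {fst, snd} \<Longrightarrow> deg g (parcs ?G') x = deg g (parcs H) x"
      "partition_on (sym_diff (parcs ?G') (parcs H)) P'"
      "\<And>D. D \<in> P' \<Longrightarrow> balanced (parcs ?G') D"
      "card (sym_diff (parcs ?G') (parcs H)) \<le> 2 * (total_weight ss + card P')"
    using Cons.IH[OF s(2) eff(1)] by blast
  have deg: "deg g (parcs G) x = deg g (parcs H) x" if "g \<in> {fst, snd}" for g x
    using eff(3)[OF that] IH(2)[OF that] by simp
  have bal: "balanced (parcs G) (sym_diff (parcs G) (parcs H))"
    using deg balanced_sym_diff_iff[OF Cons.prems(2) IH(1)] by blast
  have ne: "parcs G \<noteq> parcs ?G'" using eff(2) by auto
  obtain P where P: "partition_on (sym_diff (parcs G) (parcs H)) P" "\<And>D. D \<in> P \<Longrightarrow> balanced (parcs G) D"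
    "card (sym_diff (parcs G) (parcs H)) + 2 * card P' + 2 \<le> card (sym_diff (parcs ?G') (parcs H)) + 2 * card P
       + card (sym_diff (parcs G) (parcs ?G'))"
    using balanced_partition_flip[OF Cons.prems(2) eff(1) IH(1) bal ne IH(3,4)] by blast
  have "card (sym_diff (parcs G) (parcs H)) \<le> 2 * (total_weight (s # ss) + card P)"
    using P(3) IH(5) eff(2) by (simp add: total_weight_def)
  then show ?case using P(1,2) deg IH(1) by blast
qed

section \<open>Alternating cycles\<close>

text \<open>The cycle runs u_0, w_0, u_1, w_1, and so on; rotating \<open>us\<close> pairs each w_i
  with the next vertex of U and closes the cycle at the end.\<close>

definition cycle_arcs :: "'a list \<Rightarrow> 'a list \<Rightarrow> ('a \<times> 'a) set" where
  "cycle_arcs us ws = set (zip us ws) \<union> set (zip (rotate1 us) ws)"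

definition alternating_cycle :: "('a \<times> 'a) set \<Rightarrow> 'a list \<Rightarrow> 'a list \<Rightarrow> bool" where
  "alternating_cycle E us ws \<longleftrightarrow> us \<noteq> [] \<and> length us = length ws \<and> distinct us \<and> distinct ws \<and>
     set (zip us ws) \<subseteq> E \<and> set (zip (rotate1 us) ws) \<inter> E = {}"

definition cycle_partition :: "('a \<times> 'a) set \<Rightarrow> ('a \<times> 'a) set \<Rightarrow> ('a \<times> 'a) set set \<Rightarrow> bool" where
  "cycle_partition E S Q \<longleftrightarrow> partition_on S Q \<and>
     (\<forall>C\<in>Q. \<exists>us ws. alternating_cycle E us ws \<and> C = cycle_arcs us ws)"

text \<open>With a single vertex in each class the same arc would be both red and blue.\<close>

lemma alternating_cycle_length:
  assumes "alternating_cycle E us ws"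
  shows "2 \<le> length us"
proof (rule ccontr)
  assume "\<not> 2 \<le> length us"
  then have "length us = 1" "length ws = 1"
    using assms by (cases us; auto simp: alternating_cycle_def)+
  then obtain u w where "us = [u]" "ws = [w]" by (auto simp: length_Suc_conv)
  then show False using assms by (simp add: alternating_cycle_def)
qed

lemma alternating_cycle_cong:
  assumes "cycle_arcs us ws \<inter> E = cycle_arcs us ws \<inter> E'"
  shows "alternating_cycle E us ws \<longleftrightarrow> alternating_cycle E' us ws"
proof -
  have "set (zip us ws) \<subseteq> E \<longleftrightarrow> set (zip us ws) \<subseteq> E'"
    "set (zip (rotate1 us) ws) \<inter> E = {} \<longleftrightarrow> set (zip (rotate1 us) ws) \<inter> E' = {}"
    using assms by (auto simp: cycle_arcs_def)
  then show ?thesis by (simp add: alternating_cycle_def)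
qed

lemma alternating_cycle_card:
  assumes "alternating_cycle E us ws"
  shows "card (cycle_arcs us ws) = 2 * length us"
proof -
  have "card (set (zip us ws)) = length us" "card (set (zip (rotate1 us) ws)) = length us"
    using assms by (simp_all add: alternating_cycle_def distinct_card distinct_zipI1)
  moreover have "set (zip us ws) \<inter> set (zip (rotate1 us) ws) = {}"
    using assms by (auto simp: alternating_cycle_def)
  ultimately show ?thesis by (simp add: cycle_arcs_def card_Un_disjoint)
qed

lemma deg_set_zip:
  assumes "length us = length ws" "distinct us" "distinct ws"
  shows "deg fst (set (zip us ws)) x = (if x \<in> set us then 1 else 0)"
    "deg snd (set (zip us ws)) x = (if x \<in> set ws then 1 else 0)"
proof -
  have *: "deg g A x = card (g ` A \<inter> {x})" if "inj_on g A" "finite A" for g :: "'a \<times> 'a \<Rightarrow> 'a" and A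
  proof -
    have "deg g A x = card {e \<in> A. g e = x}" using that by (simp add: deg_card)
    also have "\<dots> = card (g ` {e \<in> A. g e = x})"
      using that by (intro card_image[symmetric]) (auto intro: inj_on_subset)
    also have "g ` {e \<in> A. g e = x} = g ` A \<inter> {x}" by auto
    finally show ?thesis .
  qed
  have inj: "inj_on fst (set (zip us ws))" "inj_on snd (set (zip us ws))"
    using assms distinct_map[of fst "zip us ws"] distinct_map[of snd "zip us ws"] by auto
  have im: "fst ` set (zip us ws) = set us" "snd ` set (zip us ws) = set ws"
    using assms by (metis list.set_map map_fst_zip, metis list.set_map map_snd_zip)
  show "deg fst (set (zip us ws)) x = (if x \<in> set us then 1 else 0)"
    "deg snd (set (zip us ws)) x = (if x \<in> set ws then 1 else 0)"
    by (simp_all add: * inj im)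
qed

text \<open>Rotation does not change the set of vertices, so each vertex of the cycle meets exactly
  one red and one blue arc.\<close>

lemma alternating_cycle_balanced:
  assumes "alternating_cycle E us ws"
  shows "balanced E (cycle_arcs us ws)"
proof -
  have "cycle_arcs us ws \<inter> E = set (zip us ws)" "cycle_arcs us ws - E = set (zip (rotate1 us) ws)"
    using assms by (auto simp: cycle_arcs_def alternating_cycle_def)
  then show ?thesis
    using assms by (simp add: balanced_def cycle_arcs_def alternating_cycle_def deg_set_zip)
qed

text \<open>By the pigeonhole principle some iterate recurs; choosing the least positive period
  makes the orbit injective.\<close>

lemma ex_periodic_point:
  fixes f :: "'b \<Rightarrow> 'b"
  assumes "finite X" "x0 \<in> X" "f ` X \<subseteq> X"
  obtains x k where "x \<in> X" "0 < k" "(f ^^ k) x = x" "inj_on (\<lambda>i. (f ^^ i) x) {..<k}"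
proof -
  have inX: "(f ^^ i) x0 \<in> X" for i
    using assms(2,3) by (induction i) auto
  then have "finite (range (\<lambda>i. (f ^^ i) x0))"
    using assms(1) by (meson finite_subset image_subset_iff)
  then have "\<not> inj (\<lambda>i. (f ^^ i) x0)"
    using finite_imageD infinite_UNIV_nat by blast
  then obtain i j where "i \<noteq> j" "(f ^^ i) x0 = (f ^^ j) x0" by (auto simp: inj_def)
  then obtain i j where ij: "i < j" "(f ^^ i) x0 = (f ^^ j) x0"
    by (metis nat_neq_iff)
  define x where "x = (f ^^ i) x0"
  have ex: "(f ^^ (j - i)) x = x \<and> 0 < j - i"
    using ij unfolding x_def by (metis comp_apply funpow_add le_add_diff_inverse2 less_imp_le zero_less_diff)
  define k where "k = (LEAST k. (f ^^ k) x = x \<and> 0 < k)"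
  have k: "(f ^^ k) x = x" "0 < k"
    using LeastI[of "\<lambda>k. (f ^^ k) x = x \<and> 0 < k", OF ex] by (simp_all add: k_def)
  have least: "\<not> ((f ^^ m) x = x \<and> 0 < m)" if "m < k" for m
    using not_less_Least that unfolding k_def by blast
  have "(f ^^ a) x \<noteq> (f ^^ b) x" if "a < b" "b < k" for a b
  proof
    assume eq: "(f ^^ a) x = (f ^^ b) x"
    \<comment> \<open>A coincidence of two iterates would give the smaller positive period
      \<open>k - b + a\<close>.\<close>
    have "(f ^^ (k - b + a)) x = (f ^^ (k - b)) ((f ^^ b) x)"
      by (simp add: funpow_add eq)
    also have "\<dots> = (f ^^ (k - b + b)) x" by (simp add: funpow_add)
    also have "\<dots> = x" using that k by simp
    finally have "(f ^^ (k - b + a)) x = x" .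
    moreover have "k - b + a < k" "0 < k - b + a" using that by linarith+
    ultimately show False using least by blast
  qed
  then have "inj_on (\<lambda>i. (f ^^ i) x) {..<k}"
    by (metis (no_types, lifting) inj_onI lessThan_iff linorder_neqE_nat)
  then show ?thesis using that[of x k] k inX[of i] by (simp add: x_def)
qed

text \<open>From a vertex of \<open>U\<close> follow a chosen red arc to \<open>W\<close> and from there a chosen blue arc back
  to \<open>U\<close>; a periodic orbit of this map is an alternating cycle.\<close>

lemma balanced_contains_cycle:
  assumes bal: "balanced E S" and ne: "S \<noteq> {}"
  obtains us ws where "alternating_cycle E us ws" "cycle_arcs us ws \<subseteq> S"
proof -
  define X where "X = fst ` (S \<inter> E)"
  define Y where "Y = snd ` (S \<inter> E)"
  have "\<forall>x\<in>X. \<exists>y. (x, y) \<in> S \<inter> E" by (auto simp: X_def)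
  then obtain r where r: "\<And>x. x \<in> X \<Longrightarrow> (x, r x) \<in> S \<inter> E" by metis
  \<comment> \<open>Balance at the head supplies a blue arc, and balance at the tail of that arc
    supplies a red one, so the walk can continue.\<close>
  have "\<exists>x. (x, y) \<in> S - E \<and> x \<in> X" if "y \<in> Y" for y
  proof -
    from that obtain e where "e \<in> S \<inter> E" "snd e = y" by (auto simp: Y_def)
    then obtain f where f: "f \<in> S - E" "snd f = y"
      using balanced_partner(1)[OF bal, of e snd] by auto
    then obtain h where "h \<in> S \<inter> E" "fst h = fst f"
      using balanced_partner(2)[OF bal, of f fst] by auto
    then have "fst f \<in> X" unfolding X_def by (metis imageI)
    then show ?thesis using f by (metis prod.collapse)
  qed
  then obtain b where b: "\<And>y. y \<in> Y \<Longrightarrow> (b y, y) \<in> S - E \<and> b y \<in> X" by metis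
  define f where "f x = b (r x)" for x
  have rY: "r x \<in> Y" if "x \<in> X" for x using r[OF that] by (force simp: Y_def)
  have fX: "f ` X \<subseteq> X" using b rY by (auto simp: f_def)
  have finX: "finite X" using bal by (simp add: X_def balanced_def)
  obtain e where e: "e \<in> S" using ne by auto
  have "X \<noteq> {}"
    using e balanced_partner(2)[OF bal e, of fst] by (cases "e \<in> E") (auto simp: X_def)
  then obtain x0 where x0: "x0 \<in> X" by auto
  obtain x k where xk: "x \<in> X" "0 < k" "(f ^^ k) x = x" "inj_on (\<lambda>i. (f ^^ i) x) {..<k}"
    by (rule ex_periodic_point[OF finX x0 fX])
  define us where "us = map (\<lambda>i. (f ^^ i) x) [0..<k]"
  define ws where "ws = map r us"
  have usX: "set us \<subseteq> X"
  proof -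
    have "(f ^^ i) x \<in> X" for i using xk(1) fX by (induction i) auto
    then show ?thesis by (auto simp: us_def)
  qed
  \<comment> \<open>The orbit closes up, so applying \<open>f\<close> shifts it cyclically by one;
    this turns the chosen blue arcs into the second half of \<open>cycle_arcs\<close>.\<close>
  have rot: "rotate1 us = map f us"
  proof (rule nth_equalityI)
    fix i assume "i < length (rotate1 us)"
    then have i: "i < k" by (simp add: us_def)
    show "rotate1 us ! i = map f us ! i"
    proof (cases "Suc i = k")
      case True
      then have "rotate1 us ! i = (f ^^ 0) x" using i by (simp add: us_def nth_rotate1)
      also have "\<dots> = f ((f ^^ i) x)" using xk(3) True by (metis funpow.simps(2) funpow_0 o_apply)
      finally show ?thesis using i by (simp add: us_def)
    next
      case False
      then show ?thesis using i by (simp add: us_def nth_rotate1)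
    qed
  qed simp
  have dus: "distinct us" using xk(4) by (simp add: us_def distinct_map atLeast0LessThan)
  \<comment> \<open>As \<open>f\<close> is \<open>b\<close> after \<open>r\<close>, injectivity of
    \<open>f\<close> on the orbit forces injectivity of \<open>r\<close>.\<close>
  have "distinct (map f us)" using dus by (simp add: rot[symmetric])
  then have dws: "distinct ws"
    unfolding ws_def f_def distinct_map by (auto simp: inj_on_def)
  have red: "set (zip us ws) = (\<lambda>u. (u, r u)) ` set us"
    by (simp add: ws_def zip_map2 zip_same_conv_map)
  have blue: "set (zip (rotate1 us) ws) = (\<lambda>u. (b (r u), r u)) ` set us"
    by (simp add: rot ws_def f_def zip_map_map zip_same_conv_map image_image)
  have "alternating_cycle E us ws"
    unfolding alternating_cycle_def red blue using dus dws xk(2) r b rY usX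
    by (auto simp: us_def[THEN arg_cong, of length] ws_def) (auto simp: us_def)
  moreover have "cycle_arcs us ws \<subseteq> S"
    unfolding cycle_arcs_def red blue using r b rY usX by auto
  ultimately show ?thesis using that by blast
qed

text \<open>Peel off one cycle; the rest is balanced and strictly smaller.\<close>

lemma balanced_cycle_partition:
  assumes "balanced E S"
  shows "\<exists>Q. cycle_partition E S Q"
proof -
  have "finite S" using assms by (rule balanced_finite)
  then show ?thesis using assms
  proof (induction S rule: finite_psubset_induct)
    case (psubset S)
    show ?case
    proof (cases "S = {}")
      case True
      then show ?thesis by (intro exI[of _ "{}"]) (simp add: cycle_partition_def partition_on_empty)
    next
      case False
      obtain us ws where c: "alternating_cycle E us ws" "cycle_arcs us ws \<subseteq> S"
        using balanced_contains_cycle[OF psubset.prems False] .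
      let ?C = "cycle_arcs us ws"
      have ne: "?C \<noteq> {}" using alternating_cycle_card[OF c(1)] alternating_cycle_length[OF c(1)] by auto
      then have "S - ?C \<subset> S" using c(2) by blast
      then obtain Q where Q: "cycle_partition E (S - ?C) Q"
        using psubset.IH balanced_Diff[OF psubset.prems alternating_cycle_balanced[OF c(1)] c(2)] by blast
      then have "disjnt ?C (\<Union>Q)" by (auto simp: cycle_partition_def partition_on_def disjnt_def)
      then have "partition_on S (insert ?C Q)"
        using Q c(2) ne by (simp add: partition_on_insert cycle_partition_def)
      then show ?thesis using Q c(1) unfolding cycle_partition_def by blast
    qed
  qed
qed

text \<open>Each part is nonempty and so splits into at least one cycle; cycles from different parts
  are disjoint and nonempty, so the counts add up.\<close>

lemma balanced_partition_refinement:
  assumes "finite P" "partition_on S P" "\<And>D. D \<in> P \<Longrightarrow> balanced E D"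
  shows "\<exists>Q. cycle_partition E S Q \<and> finite Q \<and> card P \<le> card Q"
  using assms
proof (induction P arbitrary: S rule: finite_induct)
  case empty
  then have "S = {}" by (simp add: partition_on_def)
  then show ?case by (intro exI[of _ "{}"]) (simp add: cycle_partition_def partition_on_empty)
next
  case (insert D P)
  have "disjnt D (\<Union>P)"
    using insert.prems(1) insert.hyps(2) by (auto simp: partition_on_def disjoint_def disjnt_def)
  then have D: "partition_on (S - D) P" "D \<subseteq> S" "D \<noteq> {}"
    using insert.prems(1) by (simp_all add: partition_on_insert)
  obtain Q where Q: "cycle_partition E (S - D) Q" "finite Q" "card P \<le> card Q"
    using insert.IH[OF D(1)] insert.prems(2) by blast
  obtain Q' where Q': "cycle_partition E D Q'"
    using balanced_cycle_partition insert.prems(2) by blast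
  have finQ': "finite Q'"
    using Q' finite_elements[of D Q'] insert.prems(2)[of D] balanced_finite[of E D]
    by (simp add: cycle_partition_def)
  have un: "\<Union>Q = S - D" "\<Union>Q' = D" "{} \<notin> Q" "{} \<notin> Q'" "disjoint Q" "disjoint Q'"
    using Q(1) Q' by (auto simp: cycle_partition_def partition_on_def)
  have "Q' \<noteq> {}" using un D(3) by auto
  have disj: "Q \<inter> Q' = {}"
  proof (rule ccontr)
    assume "Q \<inter> Q' \<noteq> {}"
    then obtain C where "C \<in> Q" "C \<in> Q'" by auto
    then have "C \<subseteq> (S - D) \<inter> D" using un(1,2) by blast
    then have "C = {}" by blast
    then show False using \<open>C \<in> Q\<close> un(3) by simp
  qed
  have "partition_on S (Q \<union> Q')"
  proof (rule partition_onI)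
    show "\<Union>(Q \<union> Q') = S" using un D(2) by auto
    show "disjnt p q" if "p \<in> Q \<union> Q'" "q \<in> Q \<union> Q'" "p \<noteq> q" for p q
      using that un unfolding disjoint_def disjnt_def by blast
  qed (use un in auto)
  then have "cycle_partition E S (Q \<union> Q')"
    using Q(1) Q' unfolding cycle_partition_def by blast
  moreover have "card (insert D P) \<le> card (Q \<union> Q')"
  proof -
    have "card Q' \<ge> 1" using finQ' \<open>Q' \<noteq> {}\<close> by (simp add: Suc_le_eq card_gt_0_iff)
    then show ?thesis using Q disj finQ' insert.hyps by (simp add: card_Un_disjoint)
  qed
  ultimately show ?case using Q(2) finQ' by blast
qed

section \<open>Swapping along an alternating cycle\<close>

text \<open>Triangularity depends only on the vertex set, so it can be tested in the initial graph
  for every swap of the sequence.\<close>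

definition tame_route :: "'a set \<Rightarrow> ('a \<times> 'a) set \<Rightarrow> ('a \<times> 'a) set \<Rightarrow> nat \<Rightarrow> bool" where
  "tame_route V E F w \<longleftrightarrow> (\<exists>ss. swap_sequence \<lparr>pverts = V, parcs = E\<rparr> ss \<lparr>pverts = V, parcs = F\<rparr> \<and>
     total_weight ss = w \<and>
     (\<forall>s\<in>set ss. is_C4_swap s \<or> is_triangular_C6_swap \<lparr>pverts = V, parcs = E\<rparr> s))"

definition chords :: "'a set \<Rightarrow> ('a \<times> 'a) set" where
  "chords V = {(x, y). x \<in> V \<and> y \<in> V \<and> x \<noteq> y}"

lemma chord_iff_chords: "chord G e \<longleftrightarrow> e \<in> chords (pverts G)"
  by (cases e) (simp add: chord_def chords_def)

lemma is_triangular_cong: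
  "pverts G = pverts H \<Longrightarrow> is_triangular_C6_swap G s \<longleftrightarrow> is_triangular_C6_swap H s"
  by (cases s) (simp_all add: chord_def)

lemma swap_sequence_append:
  "swap_sequence G (ss @ ts) H \<longleftrightarrow> (\<exists>K. swap_sequence G ss K \<and> swap_sequence K ts H)"
  by (induction ss arbitrary: G) auto

lemma tame_route_refl: "tame_route V E E 0"
  by (auto simp: tame_route_def total_weight_def intro!: exI[of _ "[]"])

lemma tame_route_trans:
  assumes "tame_route V E F w" "tame_route V F K w'"
  shows "tame_route V E K (w + w')"
proof -
  obtain ss ts where
    "swap_sequence \<lparr>pverts = V, parcs = E\<rparr> ss \<lparr>pverts = V, parcs = F\<rparr>" "total_weight ss = w"
    "\<forall>s\<in>set ss. is_C4_swap s \<or> is_triangular_C6_swap \<lparr>pverts = V, parcs = E\<rparr> s"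
    "swap_sequence \<lparr>pverts = V, parcs = F\<rparr> ts \<lparr>pverts = V, parcs = K\<rparr>" "total_weight ts = w'"
    "\<forall>s\<in>set ts. is_C4_swap s \<or> is_triangular_C6_swap \<lparr>pverts = V, parcs = F\<rparr> s"
    using assms by (auto simp: tame_route_def)
  then show ?thesis
    unfolding tame_route_def
    by (intro exI[of _ "ss @ ts"])
      (auto simp: swap_sequence_append total_weight_def
        is_triangular_cong[of "\<lparr>pverts = V, parcs = F\<rparr>" "\<lparr>pverts = V, parcs = E\<rparr>"])
qed

text \<open>Writing a swap as a symmetric difference with the arcs of its cycle makes successive
  swaps compose by associativity.\<close>

lemma tame_route_swap:
  assumes "cycle_vertices_distinct s" "removed_arcs s \<subseteq> E" "added_arcs s \<inter> E = {}"
    "removed_arcs s \<union> added_arcs s \<subseteq> chords V"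
    "is_C4_swap s \<or> is_triangular_C6_swap \<lparr>pverts = V, parcs = E\<rparr> s"
  shows "tame_route V E (sym_diff E (removed_arcs s \<union> added_arcs s)) (swap_weight s)"
proof -
  have "(E - removed_arcs s) \<union> added_arcs s = sym_diff E (removed_arcs s \<union> added_arcs s)"
    using assms(2,3) by auto
  then show ?thesis
    unfolding tame_route_def using assms
    by (intro exI[of _ "[s]"])
      (auto simp: allowed_swap_def apply_swap_def total_weight_def chord_iff_chords)
qed

lemma sym_diff_assoc: "sym_diff (sym_diff A B) C = sym_diff A (sym_diff B C)"
  by blast

text \<open>The diagonal \<open>(a, q)\<close> cuts the cycle into two.  The half in which the diagonal has the right
  colour goes first; this flips the diagonal, which makes the other half alternating.\<close>

lemma tame_route_split:
  assumes cyc: "alternating_cycle E (a # us1 @ us2) (ws1 @ q # ws2)"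
    and len: "length us1 = length ws1" "length us2 = length ws2" and ne: "us1 \<noteq> []" "us2 \<noteq> []"
    and ch: "cycle_arcs (a # us1 @ us2) (ws1 @ q # ws2) \<subseteq> chords V" "(a, q) \<in> chords V"
    and IH1: "\<And>E. alternating_cycle E (a # us1) (ws1 @ [q]) \<Longrightarrow>
        cycle_arcs (a # us1) (ws1 @ [q]) \<subseteq> chords V \<Longrightarrow>
        tame_route V E (sym_diff E (cycle_arcs (a # us1) (ws1 @ [q]))) (length us1)"
    and IH2: "\<And>E. alternating_cycle E (a # us2) (q # ws2) \<Longrightarrow>
        cycle_arcs (a # us2) (q # ws2) \<subseteq> chords V \<Longrightarrow>
        tame_route V E (sym_diff E (cycle_arcs (a # us2) (q # ws2))) (length us2)"
  shows "tame_route V E (sym_diff E (cycle_arcs (a # us1 @ us2) (ws1 @ q # ws2))) (length us1 + length us2)"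
proof -
  define R1 where "R1 = set (zip (a # us1) (ws1 @ [q]))"
  define R2 where "R2 = set (zip us2 ws2)"
  define B1 where "B1 = set (zip us1 ws1)"
  define B2 where "B2 = set (zip (us2 @ [a]) (q # ws2))"
  let ?C = "cycle_arcs (a # us1 @ us2) (ws1 @ q # ws2)"
  let ?C1 = "cycle_arcs (a # us1) (ws1 @ [q])"
  let ?C2 = "cycle_arcs (a # us2) (q # ws2)"
  have red: "set (zip (a # us1 @ us2) (ws1 @ q # ws2)) = R1 \<union> R2"
    using zip_append[of "a # us1" "ws1 @ [q]" us2 ws2] len by (simp add: R1_def R2_def)
  have blue: "set (zip (rotate1 (a # us1 @ us2)) (ws1 @ q # ws2)) = B1 \<union> B2"
    using len by (simp add: B1_def B2_def)
  have red2: "set (zip (a # us2) (q # ws2)) = insert (a, q) R2" by (simp add: R2_def)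
  have blue2: "set (zip (rotate1 (a # us2)) (q # ws2)) = B2" by (simp add: B2_def)
  have blue1: "set (zip (rotate1 (a # us1)) (ws1 @ [q])) = insert (a, q) B1"
    using len by (simp add: B1_def)
  have C: "?C = R1 \<union> R2 \<union> (B1 \<union> B2)" "?C1 = R1 \<union> insert (a, q) B1" "?C2 = insert (a, q) R2 \<union> B2"
    unfolding cycle_arcs_def red blue red2 blue2 blue1 by (simp_all add: R1_def)
  have E: "R1 \<subseteq> E" "R2 \<subseteq> E" "B1 \<inter> E = {}" "B2 \<inter> E = {}"
    using cyc unfolding alternating_cycle_def red blue by auto
  have dist: "distinct (a # us1 @ us2)" "distinct (ws1 @ q # ws2)"
    using cyc by (simp_all add: alternating_cycle_def)
  have disj: "R1 \<inter> R2 = {}" "B1 \<inter> B2 = {}"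
    using dist unfolding R1_def R2_def B1_def B2_def
    by (fastforce dest: set_zip_leftD)+
  have aq: "(a, q) \<notin> R2" "(a, q) \<notin> B1"
    using dist by (auto simp: R2_def B1_def dest: set_zip_leftD)
  \<comment> \<open>The red arc at \<open>a\<close> leads to the first entry of \<open>ws1\<close>,
    which exists and differs from \<open>q\<close>.\<close>
  have aqR1: "(a, q) \<notin> R1"
  proof -
    obtain p ws1' where "ws1 = p # ws1'" using len ne by (cases ws1) auto
    then show ?thesis using dist by (auto simp: R1_def dest: set_zip_leftD)
  qed
  \<comment> \<open>The blue arc of \<open>B2\<close> at \<open>q\<close> comes from the first entry
    of \<open>us2\<close>, which exists and differs from \<open>a\<close>.\<close>
  have aqB2: "(a, q) \<notin> B2"
  proof -
    obtain c us2' where "us2 = c # us2'" using ne by (cases us2) auto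
    then show ?thesis using dist by (auto simp: B2_def dest: set_zip_rightD)
  qed
  have disjRB: "(R1 \<union> R2) \<inter> (B1 \<union> B2) = {}" using E by blast
  \<comment> \<open>The diagonal lies in both halves and cancels; all other arcs lie in exactly
    one.\<close>
  have C12: "sym_diff ?C1 ?C2 = ?C" "sym_diff ?C2 ?C1 = ?C"
    using disjRB disj aq aqR1 aqB2 unfolding C by auto
  have chs: "?C1 \<subseteq> chords V" "?C2 \<subseteq> chords V" using ch by (auto simp: C)
  have alt1: "alternating_cycle F (a # us1) (ws1 @ [q]) \<longleftrightarrow> R1 \<subseteq> F \<and> insert (a, q) B1 \<inter> F = {}" for F
    unfolding alternating_cycle_def blue1 using dist len by (auto simp: R1_def)
  have alt2: "alternating_cycle F (a # us2) (q # ws2) \<longleftrightarrow> insert (a, q) R2 \<subseteq> F \<and> B2 \<inter> F = {}" for F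
    unfolding alternating_cycle_def blue2 red2 using dist len by auto
  show ?thesis
  \<comment> \<open>In the first half the diagonal takes the place of a blue arc, in the second that
    of a red arc, so its presence in \<open>E\<close> decides the order.\<close>
  proof (cases "(a, q) \<in> E")
    case False
    let ?F = "sym_diff E ?C1"
    have "tame_route V E ?F (length us1)"
      using IH1 alt1 chs(1) E False by auto
    moreover have "tame_route V ?F (sym_diff ?F ?C2) (length us2)"
      using E False disj aq aqR1 aqB2 by (intro IH2 chs(2)) (auto simp: alt2 C)
    moreover have "sym_diff ?F ?C2 = sym_diff E ?C"
      by (simp only: sym_diff_assoc C12)
    ultimately show ?thesis using tame_route_trans by metis
  next
    case True
    let ?F = "sym_diff E ?C2"
    have "tame_route V E ?F (length us2)"
      using IH2 alt2 chs(2) E True by auto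
    moreover have "tame_route V ?F (sym_diff ?F ?C1) (length us1)"
      using E True disj aq aqR1 aqB2 by (intro IH1 chs(1)) (auto simp: alt1 C)
    moreover have "sym_diff ?F ?C1 = sym_diff E ?C"
      by (simp only: sym_diff_assoc C12)
    ultimately show ?thesis using tame_route_trans by (metis add.commute)
  qed
qed

text \<open>Strong induction on the length. Cutting loses no weight: if i + j = k + 1, then (i - 1)
  + (j - 1) = k - 1.\<close>

lemma tame_route_cycle:
  assumes "alternating_cycle E us ws" "cycle_arcs us ws \<subseteq> chords V"
  shows "tame_route V E (sym_diff E (cycle_arcs us ws)) (length us - 1)"
  using assms
proof (induction "length us" arbitrary: E us ws rule: less_induct)
  case less
  have len: "length us = length ws" "2 \<le> length us"
    using less.prems(1) alternating_cycle_length[OF less.prems(1)] by (simp_all add: alternating_cycle_def)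
  have split: "tame_route V E (sym_diff E (cycle_arcs (a # us1 @ us2) (ws1 @ q # ws2))) (length us - 1)"
    if "alternating_cycle E (a # us1 @ us2) (ws1 @ q # ws2)"
      "cycle_arcs (a # us1 @ us2) (ws1 @ q # ws2) \<subseteq> chords V" "(a, q) \<in> chords V"
      "length us1 = length ws1" "length us2 = length ws2" "us1 \<noteq> []" "us2 \<noteq> []"
      "length us = Suc (length us1 + length us2)" for a us1 us2 ws1 q ws2
  proof -
    have shorter: "Suc (length us1) < length us" "Suc (length us2) < length us"
      using that(6-8) by simp_all
    have "tame_route V E (sym_diff E (cycle_arcs (a # us1 @ us2) (ws1 @ q # ws2))) (length us1 + length us2)"
    proof (rule tame_route_split[OF that(1,4,5,6,7,2,3)])
      show "tame_route V F (sym_diff F (cycle_arcs (a # us1) (ws1 @ [q]))) (length us1)"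
        if "alternating_cycle F (a # us1) (ws1 @ [q])"
          "cycle_arcs (a # us1) (ws1 @ [q]) \<subseteq> chords V" for F
        using less.hyps[OF _ that] shorter by simp
      show "tame_route V F (sym_diff F (cycle_arcs (a # us2) (q # ws2))) (length us2)"
        if "alternating_cycle F (a # us2) (q # ws2)"
          "cycle_arcs (a # us2) (q # ws2) \<subseteq> chords V" for F
        using less.hyps[OF _ that] shorter by simp
    qed
    then show ?thesis using that(8) by simp
  qed
  consider "length us = 2" | "length us = 3" | "4 \<le> length us" using len(2) by linarith
  then show ?case
  proof cases
    case 1
    then obtain a b p q where eq: "us = [a, b]" "ws = [p, q]"
      using len(1) by (auto simp: numeral_2_eq_2 length_Suc_conv)
    let ?s = "C4_Swap a p b q"
    have arcs: "cycle_arcs us ws = removed_arcs ?s \<union> added_arcs ?s"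
      by (auto simp: eq cycle_arcs_def)
    have "tame_route V E (sym_diff E (removed_arcs ?s \<union> added_arcs ?s)) (swap_weight ?s)"
      using less.prems(1)
      by (intro tame_route_swap less.prems(2)[unfolded arcs]) (simp_all add: eq alternating_cycle_def)
    moreover have "swap_weight ?s = length us - 1" by (simp add: eq)
    ultimately show ?thesis by (simp only: arcs)
  next
    case 2
    then obtain a b c p q r where eq: "us = [a, b, c]" "ws = [p, q, r]"
      using len(1) by (auto simp: numeral_3_eq_3 length_Suc_conv)
    \<comment> \<open>\<open>split\<close> cuts at the first vertex of U, so the cycle is rotated to
      bring each of the three diagonals into that position.\<close>
    have rot: "alternating_cycle E [b, c, a] [q, r, p]" "alternating_cycle E [c, a, b] [r, p, q]"
      using less.prems(1) by (auto simp: eq alternating_cycle_def)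
    have arcs: "cycle_arcs [b, c, a] [q, r, p] = cycle_arcs us ws" "cycle_arcs [c, a, b] [r, p, q] = cycle_arcs us ws"
      by (auto simp: eq cycle_arcs_def)
    consider "(a, q) \<in> chords V" | "(b, r) \<in> chords V" | "(c, p) \<in> chords V"
      | "(a, q) \<notin> chords V \<and> (b, r) \<notin> chords V \<and> (c, p) \<notin> chords V" by blast
    then show ?thesis
    proof cases
      case 1
      then show ?thesis using split[of a "[b]" "[c]" "[p]" q "[r]"] less.prems by (simp add: eq)
    next
      case 2
      then show ?thesis using split[of b "[c]" "[a]" "[q]" r "[p]"] less.prems rot(1) arcs(1) by (simp add: eq)
    next
      case 3
      then show ?thesis using split[of c "[a]" "[b]" "[r]" p "[q]"] less.prems rot(2) arcs(2) by (simp add: eq)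
    next
      case 4
      \<comment> \<open>All three opposite pairs are non-chords, which is exactly the triangular
        case.\<close>
      let ?s = "C6_Swap a p b q c r"
      have arcs: "cycle_arcs us ws = removed_arcs ?s \<union> added_arcs ?s"
        by (auto simp: eq cycle_arcs_def)
      have "tame_route V E (sym_diff E (removed_arcs ?s \<union> added_arcs ?s)) (swap_weight ?s)"
        using less.prems(1) 4
        by (intro tame_route_swap less.prems(2)[unfolded arcs])
          (simp_all add: eq alternating_cycle_def chord_iff_chords)
      moreover have "swap_weight ?s = length us - 1" by (simp add: eq)
      ultimately show ?thesis by (simp only: arcs)
    qed
  next
    case 3
    have "\<exists>a b c d zs'. zs = a # b # c # d # zs'" if "4 \<le> length zs" for zs :: "'a list"
      using that by (simp add: numeral_eq_Suc Suc_le_length_iff) blast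
    with 3 len(1) obtain a b c d us' p q r s ws'
      where eq: "us = a # b # c # d # us'" "ws = p # q # r # s # ws'" by metis
    \<comment> \<open>From length 8 on, both \<open>(a, q)\<close> and \<open>(a, r)\<close> are
      diagonals, and \<open>a\<close> can form a non-chord with only one of \<open>q\<close> and
      \<open>r\<close>.\<close>
    have "{(a, p), (b, q), (c, r)} \<subseteq> chords V" using less.prems(2) by (simp add: eq cycle_arcs_def)
    then have inV: "a \<in> V" "q \<in> V" "r \<in> V" by (auto simp: chords_def)
    have "q \<noteq> r" using less.prems(1) by (simp add: eq alternating_cycle_def)
    then consider "(a, q) \<in> chords V" | "(a, r) \<in> chords V"
      using inV by (auto simp: chords_def)
    then show ?thesis
    proof cases
      case 1
      then show ?thesis
        using split[of a "[b]" "c # d # us'" "[p]" q "r # s # ws'"] less.prems len by (simp add: eq)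
    next
      case 2
      then show ?thesis
        using split[of a "[b, c]" "d # us'" "[p, q]" r "s # ws'"] less.prems len by (simp add: eq)
    qed
  qed
qed

text \<open>Swapping along one cycle leaves the colours of the arcs in the others unchanged, so the
  cycles can be treated one after another. A cycle with 2k arcs contributes weight k - 1, hence each
  cycle saves one against half the number of arcs.\<close>

lemma tame_route_cycle_partition:
  assumes "finite Q" "finite S" "cycle_partition E S Q" "S \<subseteq> chords V"
  shows "\<exists>w. tame_route V E (sym_diff E S) w \<and> 2 * (w + card Q) = card S"
  using assms
proof (induction Q arbitrary: E S rule: finite_induct)
  case empty
  then have "S = {}" by (simp add: cycle_partition_def partition_on_def)
  then show ?case using tame_route_refl by auto
next
  case (insert C Q)
  have disj: "disjnt C (\<Union>Q)"
    using insert.prems(2) insert.hyps(2)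
    by (auto simp: cycle_partition_def partition_on_def disjoint_def disjnt_def)
  then have part: "partition_on (S - C) Q" "C \<subseteq> S"
    using insert.prems(2) by (simp_all add: partition_on_insert cycle_partition_def)
  obtain us ws where c: "alternating_cycle E us ws" "C = cycle_arcs us ws"
    using insert.prems(2) by (auto simp: cycle_partition_def)
  let ?F = "sym_diff E C"
  have route: "tame_route V E ?F (length us - 1)"
    using tame_route_cycle[OF c(1)] insert.prems(3) part(2) c(2) by auto
  have "cycle_partition ?F (S - C) Q"
    unfolding cycle_partition_def
  proof (intro conjI ballI part(1))
    fix D assume D: "D \<in> Q"
    then obtain us' ws' where d: "alternating_cycle E us' ws'" "D = cycle_arcs us' ws'"
      using insert.prems(2) by (auto simp: cycle_partition_def)
    have "D \<inter> E = D \<inter> ?F" using disj D by (auto simp: disjnt_def)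
    then show "\<exists>us ws. alternating_cycle ?F us ws \<and> D = cycle_arcs us ws"
      using d alternating_cycle_cong by blast
  qed
  then obtain w where w: "tame_route V ?F (sym_diff ?F (S - C)) w" "2 * (w + card Q) = card (S - C)"
    using insert.IH[of "S - C" ?F] insert.prems(1,3) by auto
  have "sym_diff ?F (S - C) = sym_diff E S" using part(2) by blast
  then have "tame_route V E (sym_diff E S) (length us - 1 + w)"
    using tame_route_trans[OF route w(1)] by simp
  moreover have "2 * (length us - 1 + w + card (insert C Q)) = card S"
  proof -
    have "card S = card (S - C) + card C"
      using part(2) insert.prems(1) by (metis card_Diff_subset card_mono finite_subset le_add_diff_inverse2)
    then show ?thesis
      using w(2) insert.hyps alternating_cycle_card[OF c(1)] alternating_cycle_length[OF c(1)]
      by (simp add: c(2))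
  qed
  ultimately show ?case by blast
qed

section \<open>Alternating circuits\<close>

text \<open>The two vertex lists are interleaved. Both copies of a vertex may occur on the cycle, so
  \<open>vs\<close> may repeat vertices, as a closed trail allows.\<close>

lemma alternating_cycle_circuit:
  assumes cyc: "alternating_cycle (parcs G) us ws"
    and sub: "cycle_arcs us ws \<subseteq> sym_diff (parcs G) (parcs H)"
  shows "\<exists>vs es. alternating_circuit G H vs es \<and> set es = cycle_arcs us ws"
proof -
  define n where "n = length us"
  \<comment> \<open>Position 2m carries the red arc from u_m to w_m, position 2m + 1 the blue arc
    from u_(m+1) to w_m, with indices of U taken modulo \<open>n\<close>.\<close>
  define es where "es = map (\<lambda>i. (us ! (if even i then i div 2 else Suc (i div 2) mod n), ws ! (i div 2))) [0..<2 * n]"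
  define vs where "vs = map (\<lambda>i. (if even i then us else ws) ! (i div 2)) [0..<2 * n]"
  have n: "n > 0" "length ws = n" using cyc by (auto simp: n_def alternating_cycle_def)
  have es0: "es ! (2 * m) = (us ! m, ws ! m)" and es1: "es ! Suc (2 * m) = (us ! (Suc m mod n), ws ! m)"
    and vs0: "vs ! (2 * m) = us ! m" and vs1: "vs ! Suc (2 * m) = ws ! m" if "m < n" for m
    using that by (simp_all add: es_def vs_def)
  have "set (zip us ws) = (\<lambda>m. (us ! m, ws ! m)) ` {..<n}"
    using n by (auto simp: set_zip n_def)
  then have red: "set (zip us ws) = (\<lambda>m. es ! (2 * m)) ` {..<n}" by (simp add: es0)
  have "set (zip (rotate1 us) ws) = (\<lambda>m. (us ! (Suc m mod n), ws ! m)) ` {..<n}"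
    using n by (force simp: set_zip n_def nth_rotate1)
  then have blue: "set (zip (rotate1 us) ws) = (\<lambda>m. es ! Suc (2 * m)) ` {..<n}" by (simp add: es1)
  have len: "length es = 2 * n" "length vs = 2 * n" by (simp_all add: es_def vs_def)
  have idx: "\<exists>m<n. i = 2 * m \<or> i = Suc (2 * m)" if "i < 2 * n" for i
  proof -
    have "i div 2 < n \<and> (i = 2 * (i div 2) \<or> i = Suc (2 * (i div 2)))"
      using that by presburger
    then show ?thesis by blast
  qed
  have set_es: "set es = cycle_arcs us ws"
  proof
    show "set es \<subseteq> cycle_arcs us ws"
      unfolding cycle_arcs_def red blue using idx by (force simp: in_set_conv_nth len)
    show "cycle_arcs us ws \<subseteq> set es"
      unfolding cycle_arcs_def red blue by (auto simp: len)
  qed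
  \<comment> \<open>A list of \<open>2 * n\<close> entries covering \<open>2 * n\<close> arcs has no
    repetition.\<close>
  have "distinct es"
    using alternating_cycle_card[OF cyc] by (intro card_distinct) (simp add: set_es len n_def)
  have col: "es ! (2 * m) \<in> red_arcs G H" "es ! Suc (2 * m) \<in> blue_arcs G H" if "m < n" for m
  proof -
    have "es ! (2 * m) \<in> set (zip us ws)" "es ! Suc (2 * m) \<in> set (zip (rotate1 us) ws)"
      using that unfolding red blue by auto
    then show "es ! (2 * m) \<in> red_arcs G H" "es ! Suc (2 * m) \<in> blue_arcs G H"
      using cyc sub by (auto simp: alternating_cycle_def cycle_arcs_def red_arcs_def blue_arcs_def)
  qed
  have rb: "red_arcs G H \<inter> blue_arcs G H = {}" by (auto simp: red_arcs_def blue_arcs_def)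
  have "alternating_circuit G H vs es"
    unfolding alternating_circuit_def Let_def
  proof (intro conjI allI impI)
    show "es \<noteq> []" "length vs = length es" using n len by auto
    show "distinct es" by fact
    show "set es \<subseteq> red_arcs G H \<union> blue_arcs G H"
      using sub by (simp add: set_es red_arcs_def blue_arcs_def)
    fix i assume "i < length es"
    then obtain m where m: "m < n" "i = 2 * m \<or> i = Suc (2 * m)" using idx len by auto
    let ?j = "Suc i mod length es"
    have j: "?j = (if i = 2 * m then Suc (2 * m) else 2 * (Suc m mod n))"
    proof (cases "i = 2 * m")
      case False
      then have "Suc i = 2 * Suc m" using m by simp
      then have "?j = (2 * Suc m) mod (2 * n)" by (simp only: len)
      also have "\<dots> = 2 * (Suc m mod n)" by (rule mod_mult_mult1)
      finally show ?thesis using False by simp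
    qed (use m len in simp)
    have m': "Suc m mod n < n" using n by simp
    note facts = es0 es1 vs0 vs1
    show "es ! i = (vs ! i, vs ! ?j) \<or> es ! i = (vs ! ?j, vs ! i)"
      using m(2) unfolding j by (auto simp: facts[OF m(1)] facts[OF m'])
    show "es ! i \<in> red_arcs G H \<longleftrightarrow> es ! ?j \<in> blue_arcs G H"
      using m(2) col[OF m(1)] col[OF m'] rb unfolding j by auto
    show "snd (es ! i) = vs ! ?j \<and> snd (es ! ?j) = vs ! ?j \<or> fst (es ! i) = vs ! ?j \<and> fst (es ! ?j) = vs ! ?j"
      using m(2) unfolding j by (auto simp: facts[OF m(1)] facts[OF m'])
  qed
  then show ?thesis using set_es by blast
qed

text \<open>Along a circuit consecutive arcs meet alternately in their tails and in their heads, so for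
  either end the arcs are paired off into a red and a blue one with that end in common.\<close>

lemma alternating_circuit_balanced:
  assumes circ: "alternating_circuit G H vs es"
    and loopfree: "\<And>e. e \<in> parcs G \<union> parcs H \<Longrightarrow> fst e \<noteq> snd e"
  shows "balanced (parcs G) (set es)"
proof -
  define n where "n = length es"
  define nx where "nx i = Suc i mod n" for i
  \<comment> \<open>\<open>T g\<close> holds the positions whose arc shares its \<open>g\<close>-end
    with the next arc.\<close>
  define T where "T g = {i. i < n \<and> g (es ! i) = vs ! nx i \<and> g (es ! nx i) = vs ! nx i}"
    for g :: "'a \<times> 'a \<Rightarrow> 'a"
  let ?E = "parcs G"
  have n: "0 < n" and dist: "distinct es" and sub: "set es \<subseteq> sym_diff ?E (parcs H)"
    using circ by (auto simp: alternating_circuit_def n_def red_arcs_def blue_arcs_def)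
  have step: "es ! i = (vs ! i, vs ! nx i) \<or> es ! i = (vs ! nx i, vs ! i)"
    "es ! i \<in> red_arcs G H \<longleftrightarrow> es ! nx i \<in> blue_arcs G H" "i \<in> T snd \<or> i \<in> T fst" if "i < n" for i
    using circ that by (auto simp: alternating_circuit_def Let_def n_def nx_def T_def)
  have nx: "nx i < n" for i using n by (simp add: nx_def)
  have es: "es ! i \<in> sym_diff ?E (parcs H)" if "i < n" for i
    using sub that nth_mem unfolding n_def by blast
  have nl: "fst (es ! i) \<noteq> snd (es ! i)" if "i < n" for i
    using es[OF that] loopfree by blast
  have col: "es ! i \<in> ?E \<longleftrightarrow> es ! nx i \<notin> ?E" if "i < n" for i
    using step(2)[OF that] es[OF that] es[OF nx] by (auto simp: red_arcs_def blue_arcs_def)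
  \<comment> \<open>Without loops an arc cannot have both ends at the shared vertex, so the two
    kinds of junction exclude each other.\<close>
  have one: "i \<in> T fst \<longleftrightarrow> i \<notin> T snd" if "i < n" for i
    using step(3)[OF that] nl[OF that] by (auto simp: T_def)
  \<comment> \<open>An arc that meets its predecessor in its tail must meet its successor in its
    head, and conversely.\<close>
  have "nx i \<in> T snd" if "i \<in> T fst" for i
    using step(1,3)[OF nx[of i]] nl[OF nx[of i]] that by (auto simp: T_def)
  moreover have "nx i \<in> T fst" if "i \<in> T snd" for i
    using step(1,3)[OF nx[of i]] nl[OF nx[of i]] that by (auto simp: T_def)
  ultimately have alt: "i \<in> T g \<longleftrightarrow> nx i \<notin> T g" if "i < n" "g \<in> {fst, snd}" for i g
    using one[OF that(1)] one[OF nx[of i]] that(2) by blast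
  have injnx: "inj_on nx {..<n}"
  proof (rule inj_onI)
    fix i j assume "i \<in> {..<n}" "j \<in> {..<n}" "nx i = nx j"
    then show "i = j" by (auto simp: nx_def mod_Suc split: if_splits)
  qed
  have surj: "nx ` {..<n} = {..<n}"
    using injnx nx by (intro endo_inj_surj) auto
  have "deg g (set es \<inter> ?E) x = deg g (set es - ?E) x" if g: "g \<in> {fst, snd}" for g x
  proof -
    define B where "B c = {i. i < n \<and> (es ! i \<in> ?E \<longleftrightarrow> c) \<and> g (es ! i) = x}" for c
    have fin: "finite (B c)" for c by (simp add: B_def)
    \<comment> \<open>At a junction of type \<open>g\<close>, passing to the successor keeps the
      \<open>g\<close>-end and changes the colour. Arcs in \<open>T g\<close> are paired with their
      successors, the others with their predecessors; both colours of \<open>c\<close> together give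
      the equality.\<close>
    have half: "card (B c \<inter> T g) = card (B (\<not> c) - T g)" for c
    proof -
      have "nx ` (B c \<inter> T g) = B (\<not> c) - T g"
      proof (intro equalityI subsetI)
        fix j assume "j \<in> nx ` (B c \<inter> T g)"
        then obtain i where "i \<in> B c" "i \<in> T g" "j = nx i" by auto
        then show "j \<in> B (\<not> c) - T g"
          using alt[OF _ g, of i] col[of i] nx[of i] by (auto simp: B_def T_def)
      next
        fix j assume j: "j \<in> B (\<not> c) - T g"
        then have "j \<in> nx ` {..<n}" by (simp add: surj B_def)
        then obtain i where i: "i < n" "j = nx i" by auto
        then have "i \<in> T g" using alt[OF i(1) g] j by auto
        moreover from this have "i \<in> B c" using i j col[OF i(1)] by (auto simp: B_def T_def)
        ultimately show "j \<in> nx ` (B c \<inter> T g)" using i(2) by blast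
      qed
      moreover have "inj_on nx (B c \<inter> T g)" using injnx by (rule inj_on_subset) (auto simp: B_def)
      ultimately show ?thesis using card_image by metis
    qed
    have "card (B True) = card (B False)"
      using half[of True] half[of False] card_Int_Diff[OF fin, of True "T g"]
        card_Int_Diff[OF fin, of False "T g"] by simp
    moreover have "card (B c) = card {e \<in> set es. (e \<in> ?E \<longleftrightarrow> c) \<and> g e = x}" for c
    proof -
      have "(!) es ` B c = {e \<in> set es. (e \<in> ?E \<longleftrightarrow> c) \<and> g e = x}"
        unfolding B_def n_def by (intro equalityI subsetI; force simp: in_set_conv_nth)
      moreover have "inj_on ((!) es) (B c)"
        using dist by (auto simp: inj_on_def B_def n_def nth_eq_iff_index_eq)
      ultimately show ?thesis using card_image by metis
    qed
    ultimately have "card {e \<in> set es. e \<in> ?E \<and> g e = x} = card {e \<in> set es. e \<notin> ?E \<and> g e = x}"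
      by simp
    then show ?thesis by (simp add: deg_card conj_assoc)
  qed
  then show ?thesis by (simp add: balanced_def)
qed

section \<open>The distance formula\<close>

lemma circuit_decomposition_cycle_partition:
  assumes "cycle_partition (parcs G) (sym_diff (parcs G) (parcs H)) Q"
  shows "circuit_decomposition G H Q"
  unfolding circuit_decomposition_def red_arcs_def blue_arcs_def
proof (intro conjI ballI)
  show part: "partition_on (sym_diff (parcs G) (parcs H)) Q"
    using assms by (simp add: cycle_partition_def)
  fix C assume C: "C \<in> Q"
  then obtain us ws where "alternating_cycle (parcs G) us ws" "C = cycle_arcs us ws"
    using assms by (auto simp: cycle_partition_def)
  moreover have "C \<subseteq> sym_diff (parcs G) (parcs H)" using part C by (auto simp: partition_on_def)
  ultimately show "\<exists>vs es. alternating_circuit G H vs es \<and> set es = C"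
    using alternating_cycle_circuit by blast
qed

lemma circuit_decomposition_balanced:
  assumes "circuit_decomposition G H P" "\<And>e. e \<in> parcs G \<union> parcs H \<Longrightarrow> fst e \<noteq> snd e"
  shows "partition_on (sym_diff (parcs G) (parcs H)) P" "\<And>D. D \<in> P \<Longrightarrow> balanced (parcs G) D"
proof -
  show "partition_on (sym_diff (parcs G) (parcs H)) P"
    using assms(1) by (simp add: circuit_decomposition_def red_arcs_def blue_arcs_def)
  show "balanced (parcs G) D" if "D \<in> P" for D
    using assms(1) that alternating_circuit_balanced[OF _ assms(2)]
    by (auto simp: circuit_decomposition_def)
qed

text \<open>A finite difference has finitely many partitions, and a given decomposition makes the
  set of sizes nonempty, so \<open>Max\<close> is a true maximum.\<close>

lemma card_circuit_decomposition_le: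
  assumes "finite (parcs G)" "finite (parcs H)" "circuit_decomposition G H P"
  shows "card P \<le> maxC_d G H" "\<exists>Q. circuit_decomposition G H Q \<and> card Q = maxC_d G H"
proof -
  let ?N = "{card P |P. circuit_decomposition G H P}"
  have "?N \<subseteq> card ` Pow (Pow (sym_diff (parcs G) (parcs H)))"
    by (auto simp: circuit_decomposition_def red_arcs_def blue_arcs_def partition_on_def)
  then have "finite ?N" by (rule finite_subset) (simp add: assms(1,2))
  moreover have "card P \<in> ?N" using assms(3) by blast
  ultimately show "card P \<le> maxC_d G H" unfolding maxC_d_def by (rule Max_ge)
  have "Max ?N \<in> ?N" using \<open>finite ?N\<close> \<open>card P \<in> ?N\<close> by (intro Max_in) auto
  then show "\<exists>Q. circuit_decomposition G H Q \<and> card Q = maxC_d G H"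
    unfolding maxC_d_def by auto
qed

text \<open>The value 0 outside \<open>V\<close> matters because \<open>balanced\<close> compares
  degrees at all elements of the type.\<close>

lemma realization_deg:
  assumes "realization V dout din G"
  shows "deg fst (parcs G) x = (if x \<in> V then dout x else 0)"
    "deg snd (parcs G) x = (if x \<in> V then din x else 0)"
proof -
  interpret pair_digraph G using assms by (simp add: realization_def)
  have fin: "finite (parcs G)" by (rule pair_finite_arcs)
  have V: "pverts G = V" using assms by (simp add: realization_def)
  have "{e \<in> parcs G. fst e = x} = {}" "{e \<in> parcs G. snd e = x} = {}" if "x \<notin> V"
    using that arc_fst_in_verts arc_snd_in_verts V by auto
  moreover have "card {e \<in> parcs G. fst e = x} = dout x" "card {e \<in> parcs G. snd e = x} = din x"
    if "x \<in> V"
    using assms that by (auto simp: realization_def out_degree_def in_degree_def out_arcs_def in_arcs_def)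
  ultimately show "deg fst (parcs G) x = (if x \<in> V then dout x else 0)"
    "deg snd (parcs G) x = (if x \<in> V then din x else 0)"
    using fin by (auto simp: deg_card)
qed

theorem theorem5p5:
  fixes V :: "'a set" and dout din :: "'a \<Rightarrow> nat" and G\<^sub>1 G\<^sub>2 :: "'a pair_pre_digraph"
  assumes "realization V dout din G\<^sub>1" and "realization V dout din G\<^sub>2"
  shows "real (dist' G\<^sub>1 G\<^sub>2) = H' G\<^sub>1 G\<^sub>2 - real (maxC_d G\<^sub>1 G\<^sub>2) \<and>
    (\<exists>ss. swap_sequence G\<^sub>1 ss G\<^sub>2 \<and> total_weight ss = dist' G\<^sub>1 G\<^sub>2 \<and>
      (\<forall>s \<in> set ss. is_C4_swap s \<or> is_triangular_C6_swap G\<^sub>1 s))"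
proof -
  let ?S = "sym_diff (parcs G\<^sub>1) (parcs G\<^sub>2)"
  have wf: "pair_digraph G\<^sub>1" "pair_digraph G\<^sub>2" and V: "pverts G\<^sub>1 = V" "pverts G\<^sub>2 = V"
    using assms by (auto simp: realization_def)
  have fin: "finite (parcs G\<^sub>1)" "finite (parcs G\<^sub>2)"
    using wf by (simp_all add: pair_digraph_def pair_fin_digraph.pair_finite_arcs)
  then have finS: "finite ?S" by simp
  have ch: "parcs G \<subseteq> chords (pverts G)" if "pair_digraph G" for G :: "'a pair_pre_digraph"
  proof -
    interpret pair_digraph G by fact
    show ?thesis
      using arc_fst_in_verts arc_snd_in_verts pair_no_loops by (fastforce simp: chords_def)
  qed
  have chs: "parcs G\<^sub>1 \<subseteq> chords V" "parcs G\<^sub>2 \<subseteq> chords V" using ch wf V by metis+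
  then have loopfree: "fst e \<noteq> snd e" if "e \<in> parcs G\<^sub>1 \<union> parcs G\<^sub>2" for e
    using that by (auto simp: chords_def)
  have bal: "balanced (parcs G\<^sub>1) ?S"
    using assms fin by (simp add: balanced_sym_diff_iff realization_deg)
  have G: "G\<^sub>1 = \<lparr>pverts = V, parcs = parcs G\<^sub>1\<rparr>" "G\<^sub>2 = \<lparr>pverts = V, parcs = parcs G\<^sub>2\<rparr>"
    using V by simp_all
  have refine: "\<exists>Q. cycle_partition (parcs G\<^sub>1) ?S Q \<and> finite Q \<and> circuit_decomposition G\<^sub>1 G\<^sub>2 Q \<and>
      card P \<le> card Q"
    if "partition_on ?S P" "\<And>D. D \<in> P \<Longrightarrow> balanced (parcs G\<^sub>1) D" for P
    using balanced_partition_refinement[OF finite_elements[OF finS that(1)] that]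
      circuit_decomposition_cycle_partition by blast
  \<comment> \<open>Some decomposition must exist before a maximal one can be chosen.\<close>
  obtain P0 where "circuit_decomposition G\<^sub>1 G\<^sub>2 P0"
    using balanced_cycle_partition[OF bal] circuit_decomposition_cycle_partition by blast
  then obtain P where P: "circuit_decomposition G\<^sub>1 G\<^sub>2 P" "card P = maxC_d G\<^sub>1 G\<^sub>2"
    using card_circuit_decomposition_le(2)[OF fin] by blast
  \<comment> \<open>Refining a maximal circuit decomposition into cycles cannot lose parts, and by
    maximality it cannot gain any.\<close>
  obtain Q where Q: "cycle_partition (parcs G\<^sub>1) ?S Q" "finite Q" "circuit_decomposition G\<^sub>1 G\<^sub>2 Q"
    "card P \<le> card Q"
    using refine[OF circuit_decomposition_balanced[OF P(1) loopfree]] by blast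
  have cardQ: "card Q = maxC_d G\<^sub>1 G\<^sub>2"
    using Q(4) P(2) card_circuit_decomposition_le(1)[OF fin Q(3)] by simp
  have "?S \<subseteq> chords V" using chs by blast
  then obtain w where w: "tame_route V (parcs G\<^sub>1) (sym_diff (parcs G\<^sub>1) ?S) w"
    "2 * (w + card Q) = card ?S"
    using tame_route_cycle_partition[OF Q(2) finS Q(1)] by blast
  have E2: "sym_diff (parcs G\<^sub>1) ?S = parcs G\<^sub>2" by blast
  obtain ss where ss: "swap_sequence G\<^sub>1 ss G\<^sub>2" "total_weight ss = w"
    "\<forall>s\<in>set ss. is_C4_swap s \<or> is_triangular_C6_swap G\<^sub>1 s"
    using w(1) unfolding E2 tame_route_def G[symmetric] by blast
  \<comment> \<open>The balanced partition obtained from an arbitrary sequence refines to a circuit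
    decomposition, so it has at most \<open>card Q\<close> parts.\<close>
  have lower: "w \<le> total_weight ts" if ts: "swap_sequence G\<^sub>1 ts G\<^sub>2" for ts
  proof -
    obtain P where P: "partition_on ?S P" "\<And>D. D \<in> P \<Longrightarrow> balanced (parcs G\<^sub>1) D"
      "card ?S \<le> 2 * (total_weight ts + card P)"
      using swap_sequence_balanced_partition[OF ts fin(1)] by blast
    obtain Q' where "circuit_decomposition G\<^sub>1 G\<^sub>2 Q'" "card P \<le> card Q'"
      using refine[OF P(1,2)] by blast
    then have "card P \<le> card Q"
      using card_circuit_decomposition_le(1)[OF fin] cardQ by fastforce
    then show ?thesis using P(3) w(2) by simp
  qed
  have "dist' G\<^sub>1 G\<^sub>2 = w"
    unfolding dist'_def using ss lower by (intro Least_equality) auto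
  moreover have "H' G\<^sub>1 G\<^sub>2 = real w + real (maxC_d G\<^sub>1 G\<^sub>2)"
    unfolding H'_def red_arcs_def blue_arcs_def cardQ[symmetric] w(2)[symmetric] by simp
  ultimately show ?thesis using ss by auto
qed

end
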